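(* Let $A=S+\mathcal{K}(k)\in\mathbb{R}^{3\times3}$, where $S=S^T\in\mathbb{R}^{3\times 3}$, $k\in\mathbb{R}^3$ and $$\mathcal{K}(k)=\begin{bmatrix}0&k_3&-k_2\\-k_3&0&k_1\\k_2&-k_1&0\end{bmatrix}\quad\text{for }k=\begin{bmatrix}k_1\\k_2\\k_3\end{bmatrix},$$ and define $$\mu:=\operatorname{trace}(S)/3,\qquad T:=S-\mu I_3,\qquad \xi=\max_{q\in\mathbb{R}^3,\ \|q\|_2=1}\left[\frac32(q^TTq)^2+2(k^Tq)^2\right].$$ Then, for the Frobenius distance $d_{\mathbb{R}}(A)$ from $A$ to the set of real normal $3\times3$ matrices, it holds $$d_{\mathbb{R}}(A)^2=2\|k\|_2^2+\min\left\{0,\ \|T\|_F^2-\xi\right\}.$$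
   Context: A real matrix $N$ is normal if $NN^T=N^TN$. $\|\cdot\|_F$ is the Frobenius norm and $\|\cdot\|_2$ the Euclidean norm on $\mathbb{R}^3$; $d_{\mathbb{R}}(A)=\min\{\|A-N\|_F: N\in\mathbb{R}^{3\times3}\text{ normal}\}$. *)

theory Defs
  imports "HOL-Analysis.Analysis"
begin

definition normal_matrix :: "real^'n^'n \<Rightarrow> bool" where
  "normal_matrix N \<longleftrightarrow> N ** transpose N = transpose N ** N"

definition skew3 :: "real^3 \<Rightarrow> real^3^3" where
  "skew3 k = vector [vector [0, k$3, - k$2],
                     vector [- k$3, 0, k$1],
                     vector [k$2, - k$1, 0]]"

text \<open>On \<open>real^'n^'m\<close> the library's \<open>norm\<close> is the Frobenius norm.\<close>

lemma norm_matrix_frobenius: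
  fixes A :: "real^'n^'m"
  shows "norm A = sqrt (\<Sum>i\<in>UNIV. \<Sum>j\<in>UNIV. (A$i$j)\<^sup>2)"
  by (simp add: norm_vec_def L2_set_def real_sqrt_pow2 sum_nonneg)

text \<open>\<open>LEAST\<close> and \<open>GREATEST\<close> denote a genuine minimum and maximum; without one their values
  are unspecified. The two \<open>_attained\<close> lemmas show that they exist, the
  maximum for continuous \<open>f\<close>.\<close>

definition dist_normal :: "real^'n^'n \<Rightarrow> real" where
  "dist_normal A = (LEAST d. \<exists>N. normal_matrix N \<and> d = norm (A - N))"

definition max_sphere :: "(real^'n \<Rightarrow> real) \<Rightarrow> real" where
  "max_sphere f = (GREATEST v. \<exists>q. norm q = 1 \<and> v = f q)"

lemma dist_normal_attained:
  fixes A :: "real^'n^'n"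
  obtains N where "normal_matrix N" "dist_normal A = norm (A - N)"
    "\<And>M. normal_matrix M \<Longrightarrow> dist_normal A \<le> norm (A - M)"
proof -
  have "closed {N :: real^'n^'n. normal_matrix N}"
    unfolding normal_matrix_def matrix_matrix_mult_def transpose_def
    by (intro closed_Collect_eq continuous_intros)
  moreover have "{N :: real^'n^'n. normal_matrix N} \<noteq> {}"
    by (auto simp: normal_matrix_def intro!: exI[of _ "mat 1"])
  ultimately obtain N where N: "normal_matrix N"
      "\<And>M. normal_matrix M \<Longrightarrow> norm (A - N) \<le> norm (A - M)"
    using distance_attains_inf[of "{N :: real^'n^'n. normal_matrix N}" A]
    by (auto simp: dist_norm)
  have "dist_normal A = norm (A - N)"
    unfolding dist_normal_def using N by (intro Least_equality) auto
  with N that show thesis by metis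
qed

lemma max_sphere_attained:
  fixes f :: "real^'n \<Rightarrow> real"
  assumes "continuous_on (sphere 0 1) f"
  obtains q where "norm q = 1" "max_sphere f = f q"
    "\<And>p. norm p = 1 \<Longrightarrow> f p \<le> max_sphere f"
proof -
  obtain q where q: "norm q = 1" "\<And>p. norm p = 1 \<Longrightarrow> f p \<le> f q"
    using continuous_attains_sup[OF compact_sphere _ assms] by auto
  have "max_sphere f = f q"
    unfolding max_sphere_def using q by (intro Greatest_equality) auto
  with q that show thesis by metis
qed

end

(* A normal real 3x3 matrix N = P + K(m) with P symmetric has P commuting with K(m). Either m = 0 and
   N is symmetric, or P preserves the axis q = m/|m| and commutes with the quarter turn of the plane
   orthogonal to it, so that N = a I + b q q^T + c K(q). The best symmetric approximation leaves
   the error 2|k|^2. For a fixed unit vector q, the matrices a I + b q q^T + c K(q) form a linear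
   space with orthogonal basis I, q q^T - I/3, K(q), and projecting A onto it leaves the error
   2|k|^2 + |T|^2 - 3/2 (q^T T q)^2 - 2 (k^T q)^2; it remains to optimise over q. *)
theory Submission
  imports Defs
begin

definition outer :: "real^'n \<Rightarrow> real^'n^'n" where
  "outer q = (\<chi> i j. q$i * q$j)"

lemma skew3_nth [simp]:
  "skew3 k $ 1 $ 1 = 0" "skew3 k $ 1 $ 2 = k$3" "skew3 k $ 1 $ 3 = - k$2"
  "skew3 k $ 2 $ 1 = - k$3" "skew3 k $ 2 $ 2 = 0" "skew3 k $ 2 $ 3 = k$1"
  "skew3 k $ 3 $ 1 = k$2" "skew3 k $ 3 $ 2 = - k$1" "skew3 k $ 3 $ 3 = 0"
  by (simp_all add: skew3_def)

lemma transpose_skew3: "transpose (skew3 k) = - skew3 k"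
  by (simp add: vec_eq_iff forall_3 transpose_def)

lemma skew3_scaleR: "skew3 (c *\<^sub>R k) = c *\<^sub>R skew3 k"
  by (simp add: vec_eq_iff forall_3)

lemma skew3_diff: "skew3 (k - m) = skew3 k - skew3 m"
  by (simp add: vec_eq_iff forall_3)

lemma inner_skew3: "skew3 k \<bullet> skew3 m = 2 * (k \<bullet> m)"
  by (simp add: inner_vec_def sum_3)

lemma norm_skew3_squared: "(norm (skew3 k))\<^sup>2 = 2 * (norm k)\<^sup>2"
  by (simp add: power2_norm_eq_inner inner_skew3)

lemma inner_transpose: "transpose (X :: real^'n^'m) \<bullet> transpose Y = X \<bullet> Y"
  unfolding inner_vec_def transpose_def by simp (rule sum.swap)

text \<open>Transposing both factors preserves the inner product, but here it also flips its
  sign.\<close>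

lemma inner_symmetric_skew:
  fixes X Y :: "real^'n^'n"
  assumes "transpose X = X" "transpose Y = - Y"
  shows "X \<bullet> Y = 0"
  using inner_transpose[of X Y] assms by simp

lemma transpose_outer: "transpose (outer q) = outer q"
  by (simp add: outer_def transpose_def vec_eq_iff mult.commute)

lemma inner_outer: "X \<bullet> outer q = q \<bullet> (X *v q)"
  by (simp add: inner_vec_def outer_def matrix_vector_mult_def sum_distrib_left ac_simps)

lemma inner_mat_1: "X \<bullet> mat 1 = trace (X :: real^'n^'n)"
  by (simp add: inner_vec_def mat_def trace_def if_distrib cong: if_cong)

lemma outer_mult_vec: "outer q *v v = (q \<bullet> v) *\<^sub>R q"
  by (simp add: vec_eq_iff outer_def matrix_vector_mult_def inner_vec_def sum_distrib_left ac_simps)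

lemma normal_matrix_symmetric: "transpose N = N \<Longrightarrow> normal_matrix N"
  by (simp add: normal_matrix_def)

text \<open>\<open>skew3 q\<close> annihilates \<open>q\<close>, so its products with
  \<open>outer q\<close> in either order vanish; hence the symmetric and skew parts commute.\<close>

lemma normal_matrix_axial:
  "normal_matrix (a *\<^sub>R mat 1 + b *\<^sub>R outer q + c *\<^sub>R skew3 q)"
  unfolding normal_matrix_def
  by (simp add: vec_eq_iff forall_3 matrix_matrix_mult_def transpose_def sum_3 outer_def mat_def
      algebra_simps)

text \<open>The entries (1,1) and (1,2) of the matrix identity in \<open>symmetric_commuting_skew3\<close> below, for
  \<open>q = (x, y, z)\<close> and \<open>P\<close> with diagonal \<open>a, b, c\<close> and off-diagonal entries \<open>P\<^sub>1\<^sub>2 = d\<close>, \<open>P\<^sub>1\<^sub>3 = e\<close>, \<open>P\<^sub>2\<^sub>3 = f\<close>.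
  The hypotheses are invariant under cyclic shifts of the coordinates, which yields the other entries.\<close>

lemma symmetric_commuting_entries:
  fixes x y z a b c d e f h :: real
  assumes u: "x*x + y*y + z*z = 1"
    and C: "z*d = y*e" "z*d = x*f" "z*b - y*f = a*z - e*x" "z*f - y*c = d*x - a*y"
      "x*c - z*e = b*x - d*y"
    and h: "h = x*(a*x + d*y + e*z) + y*(d*x + b*y + f*z) + z*(e*x + f*y + c*z)"
  shows "2*a = (a + b + c) - h + (3*h - (a + b + c))*(x*x)"
    and "2*d = (3*h - (a + b + c))*(x*y)"
proof -
  \<comment> \<open>K(q) annihilates q and commutes with P, so it annihilates P q as well: P q is
    parallel to q. As |q| = 1, this becomes P q = h q in \<open>1\<close>, \<open>2\<close>,
    \<open>3\<close>.\<close>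
  have r: "x*(d*x + b*y + f*z) = y*(a*x + d*y + e*z)" "x*(e*x + f*y + c*z) = z*(a*x + d*y + e*z)"
     "y*(e*x + f*y + c*z) = z*(d*x + b*y + f*z)"
    using C by algebra+
  have 1: "a*x + d*y + e*z = h*x" using r(1,2) u h by algebra
  have 2: "d*x + b*y + f*z = h*y" using r(1,3) u h by algebra
  have 3: "e*x + f*y + c*z = h*z" using r(2,3) u h by algebra
  \<comment> \<open>Entry (1,1) of P = q q^T P + K^T P K with K = K(q), which follows from K^2 = q
    q^T - I and P K = K P. Entry (1,2) of the same identity leads to \<open>4\<close>.\<close>
  have "a = x*(a*x + d*y + e*z) + b*z*z - 2*f*y*z + c*y*y" using C(3,4) u by algebra
  then show "2*a = (a + b + c) - h + (3*h - (a + b + c))*(x*x)" using 1 2 3 u by algebra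
  have 4: "d = h*x*y + d*z*z - c*x*y" using C(1,2,4) 1 u by algebra
  \<comment> \<open>Add y times the first row and x times the second row of P q = h q, then
    eliminate d by \<open>4\<close>.\<close>
  have "0 = (a + b - c - h)*x*y + 2*d*z*z" using C(1,2) 1 2 4 u by algebra
  then show "2*d = (3*h - (a + b + c))*(x*y)" using 4 by algebra
qed

text \<open>P has the eigenvalue h = q^T P q on the axis q and acts as a scalar on the plane
  orthogonal to it. By the trace this scalar is (trace P - h)/2; the coefficient of
  \<open>outer q\<close> is h minus it.\<close>

lemma symmetric_commuting_skew3:
  fixes P :: "real^3^3"
  assumes "transpose P = P" and comm: "P ** skew3 q = skew3 q ** P" and "norm q = 1"
  shows "P = ((trace P - q \<bullet> (P *v q)) / 2) *\<^sub>R mat 1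
           + ((3 * (q \<bullet> (P *v q)) - trace P) / 2) *\<^sub>R outer q"
proof -
  have "P$j$i = P$i$j" for i j
    using arg_cong[OF assms(1), of "\<lambda>X. X$i$j"] by (simp add: transpose_def)
  then have sym: "P$2$1 = P$1$2" "P$3$1 = P$1$3" "P$3$2 = P$2$3"
    by blast+
  have q: "q$1 * q$1 + q$2 * q$2 + q$3 * q$3 = 1"
    using assms(3) by (simp add: norm_eq_1 inner_vec_def sum_3)
  have C: "(P ** skew3 q) $ i $ j = (skew3 q ** P) $ i $ j" for i j
    by (simp add: comm)
  have C1: "q$3 * P$1$2 = q$2 * P$1$3" "q$3 * P$1$2 = q$1 * P$2$3"
    "q$3 * P$2$2 - q$2 * P$2$3 = P$1$1 * q$3 - P$1$3 * q$1" 
    "q$3 * P$2$3 - q$2 * P$3$3 = P$1$2 * q$1 - P$1$1 * q$2"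
    "q$1 * P$3$3 - q$3 * P$1$3 = P$2$2 * q$1 - P$1$2 * q$2"
    using C[of 1 1] C[of 2 2] C[of 1 2] C[of 1 3] C[of 2 3]
    by (simp_all add: matrix_matrix_mult_def sum_3 sym mult.commute)
  define h where "h = q \<bullet> (P *v q)"
  have h: "h = q$1*(P$1$1 * q$1 + P$1$2 * q$2 + P$1$3 * q$3)
     + q$2*(P$1$2 * q$1 + P$2$2 * q$2 + P$2$3 * q$3)
     + q$3*(P$1$3 * q$1 + P$2$3 * q$2 + P$3$3 * q$3)"
    by (simp add: h_def inner_vec_def matrix_vector_mult_def sum_3 sym)
  note 1 = symmetric_commuting_entries[OF q C1 h]
  \<comment> \<open>The shift 1 -> 2 -> 3 -> 1 gives the entries (2,2) and (2,3); applied twice, it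
    gives (3,3) and (3,1).\<close>
  have q2: "q$2 * q$2 + q$3 * q$3 + q$1 * q$1 = 1"
    using q by simp
  have C2: "q$1 * P$2$3 = q$3 * P$1$2" "q$1 * P$2$3 = q$2 * P$1$3"
    "q$1 * P$3$3 - q$3 * P$1$3 = P$2$2 * q$1 - P$1$2 * q$2"
    "q$1 * P$1$3 - q$3 * P$1$1 = P$2$3 * q$2 - P$2$2 * q$3"
    "q$2 * P$1$1 - q$1 * P$1$2 = P$3$3 * q$2 - P$2$3 * q$3"
    using C1 by (simp_all add: algebra_simps)
  have h2: "h = q$2*(P$2$2 * q$2 + P$2$3 * q$3 + P$1$2 * q$1)
     + q$3*(P$2$3 * q$2 + P$3$3 * q$3 + P$1$3 * q$1)
     + q$1*(P$1$2 * q$2 + P$1$3 * q$3 + P$1$1 * q$1)"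
    using h by (simp add: algebra_simps)
  have q3: "q$3 * q$3 + q$1 * q$1 + q$2 * q$2 = 1"
    using q by simp
  have C3: "q$2 * P$1$3 = q$1 * P$2$3" "q$2 * P$1$3 = q$3 * P$1$2"
    "q$2 * P$1$1 - q$1 * P$1$2 = P$3$3 * q$2 - P$2$3 * q$3"
    "q$2 * P$1$2 - q$1 * P$2$2 = P$1$3 * q$3 - P$3$3 * q$1"
    "q$3 * P$2$2 - q$2 * P$2$3 = P$1$1 * q$3 - P$1$3 * q$1"
    using C1 by (simp_all add: algebra_simps)
  have h3: "h = q$3*(P$3$3 * q$3 + P$1$3 * q$1 + P$2$3 * q$2)
     + q$1*(P$1$3 * q$3 + P$1$1 * q$1 + P$1$2 * q$2)
     + q$2*(P$2$3 * q$3 + P$1$2 * q$1 + P$2$2 * q$2)"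
    using h by (simp add: algebra_simps)
  note 2 = symmetric_commuting_entries[OF q2 C2 h2]
  note 3 = symmetric_commuting_entries[OF q3 C3 h3]
  have E: "2 * P$i$j = (trace P - h) * mat 1 $i$j + (3*h - trace P) * (q$i * q$j)" for i j
    using 1 2 3 sym exhaust_3[of i] exhaust_3[of j]
    by (auto simp: trace_def sum_3 mat_def ac_simps)
  have "P$i$j = (trace P - h)/2 * mat 1 $i$j + (3*h - trace P)/2 * (q$i * q$j)" for i j
    using E[of i j] by (simp add: field_simps)
  then show ?thesis
    by (simp add: vec_eq_iff outer_def h_def)
qed
text \<open>The last three squares measure the offset from the projection; 3, 2/3 and 2 are the
  squared norms of I, q q^T - I/3 and K(q). Dropping these squares gives the lower bound for the
  distance, making them vanish the upper bound.\<close>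

lemma norm_diff_axial_squared:
  fixes T :: "real^3^3"
  assumes T: "transpose T = T" "trace T = 0" and q: "norm q = 1"
  shows "(norm (T + \<mu> *\<^sub>R mat 1 + skew3 k - (a *\<^sub>R mat 1 + b *\<^sub>R outer q + c *\<^sub>R skew3 q)))\<^sup>2
    = 2 * (norm k)\<^sup>2 + (norm T)\<^sup>2 - (3/2 * (q \<bullet> (T *v q))\<^sup>2 + 2 * (k \<bullet> q)\<^sup>2)
      + 3 * (\<mu> - a - b/3)\<^sup>2 + 2/3 * (b - 3/2 * (q \<bullet> (T *v q)))\<^sup>2 + 2 * (c - k \<bullet> q)\<^sup>2"
    (is "(norm ?M)\<^sup>2 = _")
proof -
  \<comment> \<open>\<open>D\<close> and \<open>K\<close> are the symmetric and skew parts of the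
    difference, which are orthogonal.\<close>
  define D where "D = T + (\<mu> - a) *\<^sub>R mat 1 - b *\<^sub>R outer q"
  define K where "K = skew3 (k - c *\<^sub>R q)"
  have qq: "q \<bullet> q = 1"
    using q by (simp add: norm_eq_1)
  have tr: "trace (outer q) = 1"
    using qq by (simp add: outer_def trace_def inner_vec_def)
  have "transpose D = D"
    using T(1) transpose_outer[of q] by (simp add: D_def vec_eq_iff transpose_def mat_def)
  then have "D \<bullet> K = 0"
    unfolding K_def by (rule inner_symmetric_skew) (rule transpose_skew3)
  moreover have "?M = D + K"
    by (simp add: D_def K_def skew3_diff skew3_scaleR algebra_simps)
  ultimately have "(norm ?M)\<^sup>2 = D \<bullet> D + K \<bullet> K"
    by (simp add: power2_norm_eq_inner inner_add_left inner_add_right inner_commute)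
  moreover have "K \<bullet> K = 2 * (norm k)\<^sup>2 - 2 * (k \<bullet> q)\<^sup>2 + 2 * (c - k \<bullet> q)\<^sup>2"
    unfolding K_def inner_skew3 power2_norm_eq_inner
    by (simp add: inner_diff_left inner_diff_right inner_commute[of q k] qq power2_eq_square
        algebra_simps)
  moreover have "D \<bullet> D = (norm T)\<^sup>2 - 3/2 * (q \<bullet> (T *v q))\<^sup>2 + 3 * (\<mu> - a - b/3)\<^sup>2
      + 2/3 * (b - 3/2 * (q \<bullet> (T *v q)))\<^sup>2"
  proof -
    have "mat 1 \<bullet> T = 0" "T \<bullet> mat 1 = 0" "mat 1 \<bullet> outer q = 1" "outer q \<bullet> mat 1 = 1"
      "outer q \<bullet> T = T \<bullet> outer q" "outer q \<bullet> outer q = 1" "mat 1 \<bullet> (mat 1 :: real^3^3) = 3"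
      using T(2) tr qq
      by (simp_all add: inner_mat_1 inner_commute[of _ T] inner_commute[of "mat 1" "outer q"])
        (simp_all add: inner_outer outer_mult_vec trace_def sum_3 mat_def)
    then show ?thesis
      unfolding power2_norm_eq_inner
      by (simp add: D_def inner_add_left inner_add_right inner_diff_left inner_diff_right
          power2_eq_square inner_outer[symmetric] algebra_simps)
  qed
  ultimately show ?thesis by simp
qed


lemma normal_matrix_3_cases:
  fixes N :: "real^3^3"
  assumes "normal_matrix N"
  obtains (symmetric) "transpose N = N"
  | (axial) a b c q where "norm q = 1" "N = a *\<^sub>R mat 1 + b *\<^sub>R outer q + c *\<^sub>R skew3 q"
proof (cases "transpose N = N")
  case False
  define P where "P = (1/2) *\<^sub>R (N + transpose N)"
  define m :: "real^3" where
    "m = (1/2) *\<^sub>R vector [N$2$3 - N$3$2, N$3$1 - N$1$3, N$1$2 - N$2$1]"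
  have m: "skew3 m = (1/2) *\<^sub>R (N - transpose N)"
    by (simp add: vec_eq_iff forall_3 transpose_def m_def field_simps)
  have N: "N = P + skew3 m"
    by (simp add: m P_def vec_eq_iff field_simps)
  have "m \<noteq> 0"
  proof
    assume "m = 0"
    then have "skew3 m = 0" using skew3_scaleR[of 0 m] by simp
    then show False using m False by simp
  qed
  define q where "q = (1 / norm m) *\<^sub>R m"
  have q: "norm q = 1" and mq: "skew3 m = norm m *\<^sub>R skew3 q"
    using \<open>m \<noteq> 0\<close> by (simp_all add: q_def flip: skew3_scaleR)
  have "transpose P = P"
    by (simp add: P_def transpose_def vec_eq_iff add.commute)
  \<comment> \<open>The commutator of the symmetric and skew parts of N is (N^T N - N N^T)/2, which
    vanishes by normality.\<close>
  moreover have "(P ** skew3 m - skew3 m ** P) $ i $ j = (transpose N ** N - N ** transpose N) $ i $ j / 2"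
    for i j
    by (simp add: m P_def matrix_matrix_mult_def transpose_def sum_3 field_simps)
  then have "P ** skew3 m = skew3 m ** P"
    using assms by (simp add: normal_matrix_def vec_eq_iff)
  then have "P ** skew3 q = skew3 q ** P"
    using \<open>m \<noteq> 0\<close> by (simp add: mq matrix_scalar_ac flip: scalar_matrix_assoc)
  ultimately show ?thesis
    using symmetric_commuting_skew3[OF _ _ q] axial[OF q] N mq by metis
qed (rule symmetric)

theorem proposition3p3:
  fixes A S T :: "real^3^3" and k :: "real^3" and \<mu> \<xi> :: real
  assumes "transpose S = S"
    and "A = S + skew3 k"
    and "\<mu> = trace S / 3"
    and "T = S - \<mu> *\<^sub>R mat 1"
    and "\<xi> = max_sphere (\<lambda>q. 3/2 * (q \<bullet> (T *v q))\<^sup>2 + 2 * (k \<bullet> q)\<^sup>2)"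
  shows "(dist_normal A)\<^sup>2 = 2 * (norm k)\<^sup>2 + min 0 ((norm T)\<^sup>2 - \<xi>)"
proof (rule antisym)
  let ?f = "\<lambda>q. 3/2 * (q \<bullet> (T *v q))\<^sup>2 + 2 * (k \<bullet> q)\<^sup>2"
  have S: "S $ j $ i = S $ i $ j" for i j
    using arg_cong[OF assms(1), of "\<lambda>X. X $ i $ j"] by (simp add: transpose_def)
  have T: "transpose T = T" "trace T = 0"
    using S assms(3) unfolding assms(4) by (simp_all add: vec_eq_iff transpose_def mat_def trace_def sum_3)
  have A: "A = T + \<mu> *\<^sub>R mat 1 + skew3 k"
    using assms(2,4) by simp
  have cont: "continuous_on (sphere 0 1) ?f"
    unfolding matrix_vector_mult_def by (intro continuous_intros)
  obtain p where p: "norm p = 1" "\<xi> = ?f p" and max: "\<And>q. norm q = 1 \<Longrightarrow> ?f q \<le> \<xi>"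
    by (rule max_sphere_attained[OF cont], rule that) (simp_all add: assms(5))
  obtain N where N: "normal_matrix N" "dist_normal A = norm (A - N)"
    and le: "\<And>M. normal_matrix M \<Longrightarrow> dist_normal A \<le> norm (A - M)"
    using dist_normal_attained[of A] by blast
  have le2: "(dist_normal A)\<^sup>2 \<le> (norm (A - M))\<^sup>2" if "normal_matrix M" for M
    using le[OF that] N(2) by (simp add: power_mono)
  show "(dist_normal A)\<^sup>2 \<le> 2 * (norm k)\<^sup>2 + min 0 ((norm T)\<^sup>2 - \<xi>)"
  proof -
    have "(dist_normal A)\<^sup>2 \<le> 2 * (norm k)\<^sup>2"
      using le2[OF normal_matrix_symmetric[OF assms(1)]] by (simp add: assms(2) norm_skew3_squared)
    \<comment> \<open>The coefficients are those of the projection for the maximiser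
      \<open>p\<close>: they make all three offset squares vanish.\<close>
    moreover have "(dist_normal A)\<^sup>2 \<le> 2 * (norm k)\<^sup>2 + ((norm T)\<^sup>2 - \<xi>)"
      using le2[OF normal_matrix_axial[of "\<mu> - p \<bullet> (T *v p) / 2" "3/2 * (p \<bullet> (T *v p))" p "k \<bullet> p"]]
      unfolding A norm_diff_axial_squared[OF T p(1)] p(2) by simp
    ultimately show ?thesis by simp
  qed
  show "2 * (norm k)\<^sup>2 + min 0 ((norm T)\<^sup>2 - \<xi>) \<le> (dist_normal A)\<^sup>2"
    using N(1)
  proof (cases rule: normal_matrix_3_cases)
    case symmetric
    \<comment> \<open>The symmetric matrix S - N is orthogonal to \<open>skew3 k\<close>, so
      Pythagoras bounds the error below by 2|k|^2.\<close>
    have "transpose (S - N) = transpose S - transpose N"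
      by (simp add: transpose_def vec_eq_iff)
    then have "transpose (S - N) = S - N"
      by (simp only: assms(1) symmetric)
    then have "(S - N) \<bullet> skew3 k = 0"
      by (rule inner_symmetric_skew) (rule transpose_skew3)
    then have "(norm (S - N + skew3 k))\<^sup>2 = (norm (S - N))\<^sup>2 + 2 * (norm k)\<^sup>2"
      by (simp add: norm_add_Pythagorean orthogonal_def norm_skew3_squared)
    moreover have "A - N = S - N + skew3 k"
      using assms(2) by simp
    ultimately have "2 * (norm k)\<^sup>2 \<le> (dist_normal A)\<^sup>2"
      unfolding N(2) by (simp only:) simp
    then show ?thesis by simp
  next
    case (axial a b c q)
    have d: "dist_normal A = norm (T + \<mu> *\<^sub>R mat 1 + skew3 k
        - (a *\<^sub>R mat 1 + b *\<^sub>R outer q + c *\<^sub>R skew3 q))"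
      using N(2) unfolding axial(2) by (simp only: A)
    \<comment> \<open>Maximality of \<xi> bounds the projection error for this \<open>q\<close>; the
      offset squares only add to it.\<close>
    have "2 * (norm k)\<^sup>2 + ((norm T)\<^sup>2 - \<xi>) \<le> 2 * (norm k)\<^sup>2 + (norm T)\<^sup>2 - ?f q"
      using max[OF axial(1)] by simp
    then have "2 * (norm k)\<^sup>2 + ((norm T)\<^sup>2 - \<xi>) \<le> (dist_normal A)\<^sup>2"
      unfolding d norm_diff_axial_squared[OF T axial(1)] by (intro add_increasing2) simp_all
    then show ?thesis by simp
  qed
qed

end
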